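(* For each integer $r\ge 3$ let $f_{(R),r,1}(x)=1+x^2+x^{2^r}+x^{2^r+1}\in\mathbb{F}_2[x]$ (this is the reciprocal polynomial of $1+x+x^{2^r-1}+x^{2^r+1}$). Then for every $r\ge 3$ the polynomial $f_{(R),r,1}$ is robust and its order divides $4^r-1$; moreover $\displaystyle\lim_{r\to\infty}\gamma(f_{(R),r,1})=1$.
   Context: For a polynomial $f$ of degree $n$, its reciprocal polynomial is $f_{(R)}(x)=x^nf(1/x)$. For $f\in\mathbb{F}_2[x]$ with $f(0)=1$ and $\deg f\ge 1$, the order $\operatorname{ord}(f)$ is the least integer $D\ge 1$ such that $f(x)\mid 1+x^D$ in $\mathbb{F}_2[x]$. With $D=\operatorname{ord}(f)$, let $f^*(x)\in\mathbb{F}_2[x]$ be defined by $f(x)f^*(x)=1+x^D$. For $g\in\mathbb{F}_2[x]$, $\ell_1(g)$ is the number of monomials of $g$ (terms with coefficient $1$), and for $N\ge\deg g$, $\ell_{0,N}(g)$ is the number of exponents $k\in\{0,1,\dots,N\}$ for which the coefficient of $x^k$ in $g$ is $0$. Define $\gamma(f)=\ell_1(f^* )/D$. The polynomial $f$ is called robust if $\ell_1(f^* )>\ell_{0,D-1}(f^* )+1$, equivalently $\ell_1(f^* )>(D+1)/2$. *)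

theory Defs
  imports Complex_Main "HOL-Library.Z2" "HOL-Computational_Algebra.Polynomial"
begin

text \<open>
  The field \<open>F\<^sub>2\<close> is the library type \<^typ>\<open>bit\<close>, and the reciprocal polynomial
  \<open>x\<^sup>n f(1/x)\<close>, where \<open>n = deg f\<close>, is \<^const>\<open>reflect_poly\<close>.
\<close>

text \<open>Meaningful for \<open>f(0) = 1\<close> and \<open>deg f \<ge> 1\<close>, in which case such a \<open>D\<close> exists.\<close>

definition poly_ord :: "bit poly \<Rightarrow> nat" where
  "poly_ord f = (LEAST D. D \<ge> 1 \<and> f dvd 1 + monom 1 D)"

definition poly_star :: "bit poly \<Rightarrow> bit poly" where
  "poly_star f = (THE g. f * g = 1 + monom 1 (poly_ord f))"

definition ell1 :: "bit poly \<Rightarrow> nat" where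
  "ell1 g = card {k. coeff g k = 1}"

definition ell0 :: "nat \<Rightarrow> bit poly \<Rightarrow> nat" where
  "ell0 N g = card {k \<in> {0..N}. coeff g k = 0}"

definition gamma_density :: "bit poly \<Rightarrow> real" where
  "gamma_density f = real (ell1 (poly_star f)) / real (poly_ord f)"

definition robust :: "bit poly \<Rightarrow> bool" where
  "robust f \<longleftrightarrow> ell1 (poly_star f) > ell0 (poly_ord f - 1) (poly_star f) + 1"

definition fR1 :: "nat \<Rightarrow> bit poly" where
  "fR1 r = 1 + monom 1 2 + monom 1 (2 ^ r) + monom 1 (2 ^ r + 1)"

end

theory Submission
  imports Defs
begin

text \<open>
  Put \<open>q = 2 ^ r\<close>, \<open>N = q\<^sup>2 - 1\<close> and \<open>h = 1 + x + x ^ q\<close>, so that \<open>fR1 r = (1 + x) h\<close>.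
  In characteristic 2, \<open>h ^ q + h = x + x ^ (q\<^sup>2) = x (1 + x ^ N)\<close>. Moreover
  \<open>h ^ (q - 1) = (1 + x) H + x ^ (q\<^sup>2)\<close> for some \<open>H\<close> with at most \<open>3 ^ r\<close> monomials, hence
  \<open>fR1 r\<close> times \<open>(1 + x + \<dots> + x ^ N) + H\<close> equals \<open>x (1 + x ^ N)\<close>. The cofactor of \<open>fR1 r\<close>
  in \<open>1 + x ^ N\<close> therefore has at least \<open>4 ^ r - 3 ^ r\<close> monomials. It consists of \<open>N / D\<close> shifted
  copies of the cofactor in \<open>1 + x ^ D\<close>, where \<open>D\<close> is the order, so the latter has density at
  least \<open>(4 ^ r - 3 ^ r) / (4 ^ r - 1)\<close>.
\<close>

section \<open>Polynomial arithmetic in characteristic 2\<close>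

lemma two_bit_poly [simp]: "2 = (0 :: bit poly)"
  by (metis bit_2_eq_0 of_nat_numeral of_nat_poly pCons_0_0)

lemma bit_poly_add_self [simp]: "p + p = (0 :: bit poly)"
  by (simp flip: mult_2)

lemma bit_poly_add_self_left [simp]: "p + (p + q) = (q :: bit poly)"
  by (simp flip: add.assoc)

lemma bit_poly_diff_eq_add: "p - q = p + (q :: bit poly)"
  by (simp add: diff_eq_eq add.assoc)

lemma bit_poly_square_add: "(p + q)\<^sup>2 = p\<^sup>2 + (q :: bit poly)\<^sup>2"
  by (simp add: power2_eq_square algebra_simps)

lemma bit_poly_frobenius_add: "(p + q) ^ 2 ^ n = p ^ 2 ^ n + (q :: bit poly) ^ 2 ^ n"
  by (induction n) (simp_all add: power_mult mult.commute[of 2] bit_poly_square_add)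

lemma bit_poly_geometric: "(1 + p) * (\<Sum>i<n. p ^ i) = 1 + (p :: bit poly) ^ n"
  using one_diff_power_eq[of p n] by (simp add: bit_poly_diff_eq_add)

lemma monom_1_power: "monom (1 :: bit) a ^ n = monom 1 (a * n)"
  by (simp add: monom_power)

section \<open>Counting monomials\<close>

lemma ell1_eq_card_nonzero: "ell1 p = card {k. coeff p k \<noteq> 0}"
  by (simp add: ell1_def)

lemma finite_coeff_nonzero: "finite {k. coeff p k \<noteq> 0}"
  by (rule finite_subset[of _ "{..degree p}"]) (auto simp: le_degree)

lemma ell1_0 [simp]: "ell1 0 = 0"
  by (simp add: ell1_def)

lemma ell1_add_le: "ell1 (p + q) \<le> ell1 p + ell1 q"
proof -
  have "ell1 (p + q) \<le> card ({k. coeff p k \<noteq> 0} \<union> {k. coeff q k \<noteq> 0})"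
    unfolding ell1_eq_card_nonzero
    by (intro card_mono finite_UnI finite_coeff_nonzero) auto
  also have "\<dots> \<le> ell1 p + ell1 q"
    unfolding ell1_eq_card_nonzero by (rule card_Un_le)
  finally show ?thesis .
qed

lemma ell1_sum_le: "finite A \<Longrightarrow> ell1 (\<Sum>i\<in>A. p i) \<le> (\<Sum>i\<in>A. ell1 (p i))"
  by (induction A rule: finite_induct) (auto intro: order_trans[OF ell1_add_le])

lemma ell1_monom_mult [simp]: "ell1 (monom 1 n * p) = ell1 p"
proof -
  have "{k. coeff (monom 1 n * p) k \<noteq> 0} = (\<lambda>k. k + n) ` {k. coeff p k \<noteq> 0}"
    by (auto simp: coeff_monom_mult image_iff intro!: exI[of _ "_ - n"])
  then show ?thesis
    unfolding ell1_eq_card_nonzero by (simp add: card_image)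
qed

lemma ell1_1 [simp]: "ell1 1 = 1"
proof -
  have "{k. coeff (1 :: bit poly) k \<noteq> 0} = {0}"
    by auto
  then show ?thesis
    by (simp add: ell1_eq_card_nonzero)
qed

lemma ell1_sum_monom: "ell1 (\<Sum>k<n. monom 1 k) = n"
proof -
  have "{k. coeff (\<Sum>i<n. monom (1 :: bit) i) k \<noteq> 0} = {..<n}"
    by (auto simp: coeff_sum)
  then show ?thesis
    by (simp add: ell1_eq_card_nonzero)
qed

lemma ell1_le:
  assumes "degree p < n"
  shows "ell1 p \<le> n"
proof -
  have "ell1 p \<le> card {..<n}"
    unfolding ell1_eq_card_nonzero using assms le_degree[of p]
    by (intro card_mono) (auto intro: le_less_trans)
  then show ?thesis
    by simp
qed

lemma ell0_plus_ell1:
  assumes "degree p \<le> n"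
  shows "ell0 n p + ell1 p = n + 1"
proof -
  have "{0..n} = {k \<in> {0..n}. coeff p k = 0} \<union> {k. coeff p k \<noteq> 0}"
    using le_trans[OF le_degree assms] by auto
  moreover have "card ({k \<in> {0..n}. coeff p k = 0} \<union> {k. coeff p k \<noteq> 0}) = ell0 n p + ell1 p"
    unfolding ell0_def ell1_eq_card_nonzero
    by (intro card_Un_disjoint finite_coeff_nonzero) auto
  ultimately have "card {0..n} = ell0 n p + ell1 p"
    by (rule ssubst)
  then show ?thesis
    by simp
qed

section \<open>Sparse powers of trinomials\<close>

lemma trinomial_square:
  "(1 + monom 1 a + monom 1 b)\<^sup>2 = 1 + monom 1 (2 * a) + monom (1 :: bit) (2 * b)"
  by (simp add: bit_poly_square_add monom_1_power mult.commute)

text \<open>The exponent is \<open>1 + 2 * (2 ^ n - 1)\<close>, and squaring a trinomial only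
  doubles \<open>a\<close> and \<open>b\<close>. Inductions along this recursion must therefore keep
  \<open>a\<close> and \<open>b\<close> arbitrary.\<close>

lemma trinomial_power_Suc:
  fixes a b n :: nat
  defines "t \<equiv> 1 + monom (1 :: bit) a + monom 1 b"
  shows "t ^ (2 ^ Suc n - 1) = t * (1 + monom 1 (2 * a) + monom 1 (2 * b)) ^ (2 ^ n - 1)"
proof -
  have "2 ^ Suc n - 1 = Suc (2 * (2 ^ n - 1 :: nat))"
    by (cases "2 ^ n :: nat") simp_all
  then show ?thesis
    unfolding t_def by (simp only: power_Suc power_mult trinomial_square)
qed

lemma ell1_trinomial_mult_le:
  "ell1 ((1 + monom 1 a + monom 1 b) * p) \<le> 3 * ell1 p"
  using ell1_add_le[of "p + monom 1 a * p" "monom 1 b * p"] ell1_add_le[of p "monom 1 a * p"]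
  by (simp add: distrib_right)

lemma ell1_trinomial_power_le: "ell1 ((1 + monom 1 a + monom 1 b) ^ (2 ^ n - 1)) \<le> 3 ^ n"
proof (induction n arbitrary: a b)
  case (Suc n)
  show ?case
    unfolding trinomial_power_Suc
    using order_trans[OF ell1_trinomial_mult_le mult_le_mono2[OF Suc.IH]] by simp
qed simp

text \<open>Modulo \<open>1 + x ^ a\<close> the trinomial is congruent to \<open>x ^ b\<close>, so
  its power is congruent to \<open>x ^ (b * (2 ^ n - 1))\<close>. The extra shift
  \<open>a * 2 ^ n\<close> does not change this residue; it makes the exponent \<open>4 ^ n\<close>
  when \<open>a = 1\<close> and \<open>b = 2 ^ n\<close>. The real content is that the quotient is
  sparse.\<close>

lemma trinomial_power_remainder:
  "\<exists>H. (1 + monom 1 a + monom 1 b) ^ (2 ^ n - 1)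
      = (1 + monom 1 a) * H + monom 1 (a * 2 ^ n + b * (2 ^ n - 1)) \<and> ell1 H \<le> 3 ^ n"
proof (induction n arbitrary: a b)
  case 0
  show ?case
    by (rule exI[of _ 1]) (simp add: add.assoc)
next
  case (Suc n)
  define F where "F = (1 + monom 1 (2 * a) + monom (1 :: bit) (2 * b)) ^ (2 ^ n - 1)"
  define c where "c = monom (1 :: bit) (2 * a * 2 ^ n + 2 * b * (2 ^ n - 1))"
  obtain H where F: "F = (1 + monom 1 (2 * a)) * H + c" and H: "ell1 H \<le> 3 ^ n"
    using Suc.IH[of "2 * a" "2 * b"] unfolding F_def c_def by blast
  define y where "y = monom (1 :: bit) a"
  define z where "z = monom (1 :: bit) b"
  \<comment> \<open>Split \<open>(1 + y + z) * F\<close> as \<open>(1 + y) * F + z * F\<close>.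
    Since \<open>1 + y * y = (1 + y) * (1 + y)\<close>, the second summand contributes
    \<open>z * (1 + y) * H\<close> to the quotient. The count is at most
    \<open>3 ^ n + 2 * 3 ^ n\<close>.\<close>
  define K where "K = F + z * ((1 + y) * H)"
  have y2: "monom 1 (2 * a) = y * y"
    by (simp add: y_def mult_monom mult_2)
  have "b + (2 * a * 2 ^ n + 2 * b * (2 ^ n - 1)) = a * 2 ^ Suc n + b * (2 ^ Suc n - 1)"
    using one_le_power[of "2 :: nat" n]
    by (cases "2 ^ n :: nat") (simp_all add: algebra_simps)
  then have zc: "z * c = monom 1 (a * 2 ^ Suc n + b * (2 ^ Suc n - 1))"
    by (simp only: z_def c_def mult_monom mult_1)
  have "z * F = (1 + y) * (z * ((1 + y) * H)) + z * c"
    unfolding F y2 by (simp add: algebra_simps)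
  then have "(1 + y + z) * F = (1 + y) * K + z * c"
    unfolding K_def by (simp add: algebra_simps)
  then have eq: "(1 + monom 1 a + monom 1 b) ^ (2 ^ Suc n - 1)
      = (1 + monom 1 a) * K + monom 1 (a * 2 ^ Suc n + b * (2 ^ Suc n - 1))"
    unfolding zc trinomial_power_Suc unfolding F_def y_def z_def .
  have "ell1 (z * ((1 + y) * H)) \<le> ell1 H + ell1 H"
    using ell1_add_le[of H "y * H"] by (simp add: z_def y_def distrib_right)
  moreover have "ell1 F \<le> 3 ^ n"
    unfolding F_def by (rule ell1_trinomial_power_le)
  ultimately have "ell1 K \<le> 3 ^ Suc n"
    using ell1_add_le[of F "z * ((1 + y) * H)"] H unfolding K_def by simp
  with eq show ?case
    by blast
qed

section \<open>The order and the cofactor of a polynomial\<close>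

lemma poly_ord_least:
  assumes "f dvd 1 + monom 1 N" "N \<ge> 1"
  shows "poly_ord f \<ge> 1" "f dvd 1 + monom 1 (poly_ord f)"
    "\<And>m. m \<ge> 1 \<Longrightarrow> f dvd 1 + monom 1 m \<Longrightarrow> poly_ord f \<le> m"
proof -
  show "poly_ord f \<ge> 1" "f dvd 1 + monom 1 (poly_ord f)"
    unfolding poly_ord_def using assms LeastI[of "\<lambda>D. D \<ge> 1 \<and> f dvd 1 + monom 1 D" N] by auto
  show "poly_ord f \<le> m" if "m \<ge> 1" "f dvd 1 + monom 1 m" for m
    unfolding poly_ord_def using that by (auto intro: Least_le)
qed

lemma one_add_monom_mult:
  "1 + monom (1 :: bit) (D * k) = (1 + monom 1 D) * (\<Sum>i<k. monom 1 (D * i))"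
  using bit_poly_geometric[of "monom 1 D" k] by (simp add: monom_1_power)

lemma poly_ord_dvd:
  assumes f: "f dvd 1 + monom 1 N" and N: "N \<ge> 1"
  shows "poly_ord f dvd N"
proof -
  define D where "D = poly_ord f"
  define m where "m = N mod D"
  have "f dvd 1 + monom 1 (D * (N div D))"
    unfolding one_add_monom_mult D_def using poly_ord_least(2)[OF f N] by (rule dvd_mult2)
  \<comment> \<open>With \<open>N = D * (N div D) + m\<close>, the two copies of
    \<open>x ^ N\<close> cancel. This leaves \<open>1 + x ^ m\<close> with \<open>m < D\<close>, so
    minimality of the order forces \<open>m = 0\<close>.\<close>
  then have "f dvd 1 + monom 1 N + monom 1 m * (1 + monom 1 (D * (N div D)))"
    by (rule dvd_add[OF f dvd_mult])
  also have "\<dots> = 1 + monom 1 m"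
    by (simp add: distrib_left mult_monom m_def add_ac)
  finally have "f dvd 1 + monom 1 m" .
  moreover have "m < poly_ord f"
    using poly_ord_least(1)[OF f N] by (simp add: m_def D_def)
  ultimately have "m = 0"
    using poly_ord_least(3)[OF f N, of m] by linarith
  then show ?thesis
    by (simp add: m_def D_def mod_eq_0_iff_dvd)
qed

lemma degree_one_add_monom: "D \<ge> 1 \<Longrightarrow> degree (1 + monom (1 :: bit) D) = D"
  by (simp add: degree_add_eq_right degree_monom_eq)

lemma degree_le_poly_ord:
  assumes f: "f dvd 1 + monom 1 N" and N: "N \<ge> 1"
  shows "degree f \<le> poly_ord f"
proof -
  note D = poly_ord_least(1,2)[OF f N]
  have "1 + monom (1 :: bit) (poly_ord f) \<noteq> 0"
    using degree_one_add_monom[OF D(1)] D(1) by auto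
  then show ?thesis
    using dvd_imp_degree_le[OF D(2)] degree_one_add_monom[OF D(1)] by simp
qed

text \<open>As \<open>f\<close> is nonzero, cancellation makes the cofactor unique, so the definite
  description in \<open>poly_star\<close> denotes it.\<close>

lemma poly_star_mult:
  assumes f: "f dvd 1 + monom 1 N" and N: "N \<ge> 1"
  shows "f * poly_star f = 1 + monom 1 (poly_ord f)"
proof -
  note D = poly_ord_least(1,2)[OF f N]
  have "1 + monom (1 :: bit) (poly_ord f) \<noteq> 0"
    using degree_one_add_monom[OF D(1)] D(1) by auto
  with D(2) have "f \<noteq> 0"
    by auto
  with D(2) have "\<exists>!g. f * g = 1 + monom 1 (poly_ord f)"
    by (metis dvd_def mult_left_cancel)
  then show ?thesis
    unfolding poly_star_def by (rule theI')
qed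

lemma degree_poly_star_less:
  assumes f: "f dvd 1 + monom 1 N" and N: "N \<ge> 1" and deg: "degree f \<ge> 1"
  shows "degree (poly_star f) < poly_ord f"
proof -
  have "degree (f * poly_star f) = poly_ord f" "poly_ord f \<ge> 1"
    using poly_star_mult[OF f N] degree_one_add_monom poly_ord_least(1)[OF f N] by simp_all
  moreover from this have "f \<noteq> 0" "poly_star f \<noteq> 0"
    by auto
  ultimately show ?thesis
    using deg by (simp add: degree_mult_eq)
qed

text \<open>The cofactor \<open>g\<close> is the sum of \<open>N / D\<close> shifts of
  \<open>poly_star f\<close> by multiples of the order \<open>D\<close>, and \<open>ell1\<close> is
  subadditive. Cross-multiplied, this says that the density of \<open>g\<close> bounds
  \<open>gamma_density f\<close> from below.\<close>

lemma ell1_cofactor_le: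
  assumes eq: "f * g = 1 + monom 1 N" and N: "N \<ge> 1"
  shows "poly_ord f * ell1 g \<le> N * ell1 (poly_star f)"
proof -
  have f: "f dvd 1 + monom 1 N"
    by (metis eq dvd_triv_left)
  define k where "k = N div poly_ord f"
  have k: "N = poly_ord f * k"
    using poly_ord_dvd[OF f N] by (simp add: k_def)
  have "f * g = f * (poly_star f * (\<Sum>i<k. monom 1 (poly_ord f * i)))"
    unfolding eq mult.assoc[symmetric] poly_star_mult[OF f N] one_add_monom_mult[symmetric]
      k[symmetric] ..
  moreover have "f \<noteq> 0"
    using degree_one_add_monom[OF N] N eq by auto
  ultimately have "g = (\<Sum>i<k. monom 1 (poly_ord f * i)) * poly_star f"
    by (simp add: mult.commute)
  then have "g = (\<Sum>i<k. monom 1 (poly_ord f * i) * poly_star f)"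
    by (simp only: sum_distrib_right)
  then have "ell1 g \<le> (\<Sum>i<k. ell1 (monom 1 (poly_ord f * i) * poly_star f))"
    by (simp only: ell1_sum_le finite_lessThan)
  then have "ell1 g \<le> k * ell1 (poly_star f)"
    by simp
  then show ?thesis
    by (subst k) (simp add: mult.assoc)
qed

section \<open>The cofactor of the given family\<close>

lemma fR1_factor: "fR1 r = (1 + monom 1 1) * (1 + monom 1 1 + monom 1 (2 ^ r))"
  by (simp add: fR1_def algebra_simps mult_monom numeral_2_eq_2)

lemma fR1_cofactor:
  "\<exists>g. fR1 r * g = 1 + monom 1 (4 ^ r - 1) \<and> 4 ^ r \<le> ell1 g + 3 ^ r"
proof -
  define q :: nat where "q = 2 ^ r"
  define x where "x = monom (1 :: bit) 1"
  define h where "h = 1 + x + monom 1 q"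
  define W where "W = (\<Sum>k<4 ^ r. monom (1 :: bit) k)"
  have q4: "q * q = 4 ^ r"
    by (simp add: q_def flip: power_mult_distrib)
  have q1: "q \<ge> 1"
    by (simp add: q_def)
  \<comment> \<open>This is the remainder exponent for \<open>a = 1\<close>,
    \<open>b = q\<close>.\<close>
  have "1 * 2 ^ r + q * (2 ^ r - 1) = 4 ^ r"
    using q1 q4 by (cases q) (simp_all add: q_def)
  then obtain H where hH: "h ^ (q - 1) = (1 + x) * H + monom 1 (4 ^ r)" and H: "ell1 H \<le> 3 ^ r"
    using trinomial_power_remainder[of 1 q r] unfolding h_def x_def q_def by metis
  have W: "(1 + x) * W = 1 + monom 1 (4 ^ r)"
    using one_add_monom_mult[of 1 "4 ^ r"] by (simp add: W_def x_def)
  \<comment> \<open>The left side is \<open>h ^ q\<close>, which Frobenius expands termwise.\<close>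
  have hq: "h * h ^ (q - 1) = 1 + monom 1 q + monom 1 (4 ^ r)"
    using q1 q4 by (simp add: h_def x_def q_def bit_poly_frobenius_add monom_1_power
        flip: power_Suc)
  have "(1 + x) * (W + H) = 1 + h ^ (q - 1)"
    unfolding distrib_left W hH by (simp add: add_ac)
  then have "fR1 r * (W + H) = h * (1 + h ^ (q - 1))"
    unfolding fR1_factor x_def[symmetric] q_def[symmetric] h_def[symmetric]
    by (metis mult.assoc mult.commute)
  also have "\<dots> = x + monom 1 (4 ^ r)"
    unfolding distrib_left hq by (simp add: h_def add_ac)
  also have "\<dots> = x * (1 + monom 1 (4 ^ r - 1))"
    by (simp add: x_def distrib_left mult_monom)
  finally have eq: "fR1 r * (W + H) = x * (1 + monom 1 (4 ^ r - 1))" .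
  \<comment> \<open>The factor \<open>x\<close> on the right must divide \<open>W + H\<close>,
    because \<open>fR1 r\<close> has constant term 1. Cancelling it leaves the cofactor
    \<open>g\<close>.\<close>
  have "coeff (fR1 r) 0 = 1"
    by (simp add: fR1_def)
  moreover have "coeff (fR1 r * (W + H)) 0 = 0"
    unfolding eq by (simp add: x_def coeff_mult_0)
  ultimately have "coeff (W + H) 0 = 0"
    by (simp add: coeff_mult_0)
  then have "x dvd W + H"
    unfolding x_def by (simp add: monom_1_dvd_iff')
  then obtain g where g: "W + H = x * g"
    by (auto elim: dvdE)
  have "x \<noteq> 0"
    by (simp add: x_def)
  with eq have "fR1 r * g = 1 + monom 1 (4 ^ r - 1)"
    unfolding g by (metis mult.left_commute mult_left_cancel)
  \<comment> \<open>\<open>W\<close> has exactly \<open>4 ^ r\<close> monomials, of which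
    \<open>H\<close> accounts for at most \<open>3 ^ r\<close>.\<close>
  moreover have "W = x * g + H"
    by (simp add: g[symmetric] add.assoc)
  then have "4 ^ r \<le> ell1 g + 3 ^ r"
    using ell1_add_le[of "x * g" H] H ell1_sum_monom[of "4 ^ r"] by (simp add: W_def x_def)
  ultimately show ?thesis
    by blast
qed

lemma four_power_minus_one_ge: "r \<ge> 1 \<Longrightarrow> (4 :: nat) ^ r - 1 \<ge> 1"
  using power_increasing[of 1 r "4 :: nat"] by simp

lemma fR1_dvd: "fR1 r dvd 1 + monom 1 (4 ^ r - 1)"
  using fR1_cofactor by (metis dvd_triv_left)

lemma degree_fR1:
  assumes "r \<ge> 1"
  shows "degree (fR1 r) = 2 ^ r + 1"
proof -
  have "(2 :: nat) \<le> 2 ^ r"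
    using assms power_increasing[of 1 r "2 :: nat"] by simp
  then have "degree (1 + monom 1 2 + monom (1 :: bit) (2 ^ r)) < degree (monom (1 :: bit) (2 ^ r + 1))"
    by (intro degree_add_less) (simp_all add: degree_monom_eq)
  then show ?thesis
    unfolding fR1_def by (simp add: degree_add_eq_right degree_monom_eq)
qed

lemma ell1_poly_star_fR1_ge:
  assumes "r \<ge> 1"
  shows "poly_ord (fR1 r) * (4 ^ r - 3 ^ r) \<le> (4 ^ r - 1) * ell1 (poly_star (fR1 r))"
proof -
  obtain g where g: "fR1 r * g = 1 + monom 1 (4 ^ r - 1)" "4 ^ r \<le> ell1 g + 3 ^ r"
    using fR1_cofactor by blast
  have "poly_ord (fR1 r) * (4 ^ r - 3 ^ r) \<le> poly_ord (fR1 r) * ell1 g"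
    using g(2) by (intro mult_le_mono2) simp
  also have "\<dots> \<le> (4 ^ r - 1) * ell1 (poly_star (fR1 r))"
    using g(1) four_power_minus_one_ge[OF assms] by (rule ell1_cofactor_le)
  finally show ?thesis .
qed

section \<open>Robustness and density\<close>

text \<open>The numerical core of robustness; 3 is the least exponent for which it holds. In the
  induction, tripling the hypothesis leaves \<open>4 \<le> 4 ^ n + 2 ^ n\<close>.\<close>

lemma two_three_four_power_bound: "r \<ge> 3 \<Longrightarrow> 2 * 3 ^ r + 2 ^ r < (4 :: int) ^ r + 2"
proof (induction r rule: dec_induct)
  case (step n)
  have "(1 :: int) \<le> 2 ^ n" "(4 :: int) \<le> 4 ^ n"
    using step.hyps power_increasing[of 1 n "4 :: int"] by simp_all
  with step.IH show ?case
    unfolding power_Suc by linarith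
qed simp

lemma robust_fR1:
  assumes r: "r \<ge> 3"
  shows "robust (fR1 r)"
proof -
  define D where "D = poly_ord (fR1 r)"
  define L where "L = ell1 (poly_star (fR1 r))"
  have r1: "r \<ge> 1" and N: "(4 :: nat) ^ r - 1 \<ge> 1"
    using r four_power_minus_one_ge[of r] by auto
  have deg: "degree (poly_star (fR1 r)) < D"
    unfolding D_def using degree_fR1[OF r1] by (intro degree_poly_star_less[OF fR1_dvd N]) simp
  \<comment> \<open>Robustness asks for \<open>2 * L > D + 1\<close>, so density above one half must
    also absorb the summand 1. That takes a lower bound on \<open>D\<close>, supplied here by the
    degree.\<close>
  have D: "int D \<ge> 2 ^ r + 1"
    using degree_le_poly_ord[OF fR1_dvd N] degree_fR1[OF r1] unfolding D_def
    by (metis (mono_tags) of_nat_1 of_nat_add of_nat_le_iff of_nat_numeral of_nat_power)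
  have "int (D * (4 ^ r - 3 ^ r)) \<le> int ((4 ^ r - 1) * L)"
    unfolding D_def L_def of_nat_le_iff by (rule ell1_poly_star_fR1_ge[OF r1])
  then have L: "int D * (4 ^ r - 3 ^ r) \<le> (4 ^ r - 1) * int L"
    by (simp add: of_nat_diff power_mono)
  \<comment> \<open>The goal reduces to \<open>4 ^ r - 1 < D * (4 ^ r - 2 * 3 ^ r + 1)\<close>. The
    factor \<open>2 ^ r + 1\<close> is the lower bound for \<open>D\<close>, and
    \<open>2 ^ r - 1\<close> is compared with the other factor.\<close>
  have "(4 :: int) ^ r - 1 = (2 ^ r + 1) * (2 ^ r - 1)"
    by (simp add: algebra_simps flip: power_mult_distrib)
  also have "\<dots> < (2 ^ r + 1) * (4 ^ r - 2 * 3 ^ r + 1)"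
    using two_three_four_power_bound[OF r] by (intro mult_strict_left_mono) (simp_all add: add_pos_pos)
  also have "\<dots> \<le> int D * (4 ^ r - 2 * 3 ^ r + 1)"
    using D two_three_four_power_bound[OF r] one_le_power[of "2 :: int" r]
    by (intro mult_right_mono) linarith+
  finally have "(4 ^ r - 1) * (int D + 1) < 2 * (int D * (4 ^ r - 3 ^ r))"
    by (simp add: algebra_simps)
  also have "\<dots> \<le> (4 ^ r - 1) * (2 * int L)"
    using L by simp
  finally have "int D + 1 < 2 * int L"
    using one_le_power[of "4 :: int" r] by (simp add: mult_less_cancel_left)
  moreover have "ell0 (D - 1) (poly_star (fR1 r)) + L = D"
    using ell0_plus_ell1[of "poly_star (fR1 r)" "D - 1"] deg unfolding L_def by simp
  ultimately show ?thesis
    unfolding robust_def D_def[symmetric] L_def[symmetric] by linarith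
qed

lemma gamma_density_fR1_bounds:
  assumes r: "r \<ge> 1"
  shows "1 - (3 / 4) ^ r \<le> gamma_density (fR1 r)" "gamma_density (fR1 r) \<le> 1"
proof -
  define D where "D = poly_ord (fR1 r)"
  define L where "L = ell1 (poly_star (fR1 r))"
  note N = four_power_minus_one_ge[OF r]
  have D: "real D > 0"
    using poly_ord_least(1)[OF fR1_dvd N] unfolding D_def by simp
  have "real (D * (4 ^ r - 3 ^ r)) \<le> real ((4 ^ r - 1) * L)"
    unfolding D_def L_def of_nat_le_iff by (rule ell1_poly_star_fR1_ge[OF r])
  then have "real D * (4 ^ r - 3 ^ r) \<le> (4 ^ r - 1) * real L"
    by (simp add: of_nat_diff power_mono)
  \<comment> \<open>Enlarging \<open>4 ^ r - 1\<close> to \<open>4 ^ r\<close> gives the clean bound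
    \<open>1 - (3 / 4) ^ r\<close>.\<close>
  also have "\<dots> \<le> 4 ^ r * real L"
    by (simp add: mult_right_mono)
  finally show "1 - (3 / 4) ^ r \<le> gamma_density (fR1 r)"
    using D unfolding gamma_density_def D_def[symmetric] L_def[symmetric]
    by (simp add: field_simps)
  have "L \<le> D"
    unfolding D_def L_def using degree_fR1[OF r]
    by (intro ell1_le degree_poly_star_less[OF fR1_dvd N]) simp
  then show "gamma_density (fR1 r) \<le> 1"
    using D unfolding gamma_density_def D_def[symmetric] L_def[symmetric] by simp
qed

section \<open>The reciprocal form and the conclusion\<close>

lemma fR1_eq_reflect_poly:
  assumes "r \<ge> 3"
  shows "fR1 r = reflect_poly (1 + monom 1 1 + monom 1 (2 ^ r - 1) + monom 1 (2 ^ r + 1))"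
proof -
  define q :: nat where "q = 2 ^ r"
  define p where "p = 1 + monom 1 1 + monom 1 (q - 1) + monom (1 :: bit) (q + 1)"
  have q: "q \<ge> 8"
    using power_increasing[OF assms, of "2 :: nat"] by (simp add: q_def)
  then have "degree (1 + monom 1 1 + monom (1 :: bit) (q - 1)) < degree (monom (1 :: bit) (q + 1))"
    by (intro degree_add_less) (simp_all add: degree_monom_eq)
  then have deg: "degree p = q + 1"
    unfolding p_def by (simp add: degree_add_eq_right degree_monom_eq)
  \<comment> \<open>Reflection sends the exponents 0, 1, \<open>q - 1\<close>, \<open>q + 1\<close>
    to \<open>q + 1\<close>, \<open>q\<close>, 2, 0; the bound on \<open>q\<close> keeps them
    distinct.\<close>
  have "coeff (fR1 r) k = coeff (reflect_poly p) k" for k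
    using q unfolding coeff_reflect_poly deg
    by (auto simp: fR1_def p_def q_def[symmetric] coeff_1)
  then have "fR1 r = reflect_poly p"
    by (rule poly_eqI)
  then show ?thesis
    by (simp add: p_def q_def)
qed

theorem mainTheorem2:
  shows "(\<forall>r\<ge>3. fR1 r = reflect_poly (1 + monom 1 1 + monom 1 (2 ^ r - 1) + monom 1 (2 ^ r + 1))
            \<and> robust (fR1 r) \<and> poly_ord (fR1 r) dvd 4 ^ r - 1)
         \<and> (\<lambda>r. gamma_density (fR1 r)) \<longlonglongrightarrow> 1"
proof (intro conjI allI impI)
  fix r :: nat
  assume r: "r \<ge> 3"
  show "fR1 r = reflect_poly (1 + monom 1 1 + monom 1 (2 ^ r - 1) + monom 1 (2 ^ r + 1))"
    using r by (rule fR1_eq_reflect_poly)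
  show "robust (fR1 r)"
    using r by (rule robust_fR1)
  show "poly_ord (fR1 r) dvd 4 ^ r - 1"
    using r by (intro poly_ord_dvd[OF fR1_dvd] four_power_minus_one_ge) simp
next
  have "(\<lambda>r. 1 - (3 / 4 :: real) ^ r) \<longlonglongrightarrow> 1 - 0"
    by (intro tendsto_intros LIMSEQ_power_zero) simp
  then have lower: "(\<lambda>r. 1 - (3 / 4 :: real) ^ r) \<longlonglongrightarrow> 1"
    by simp
  show "(\<lambda>r. gamma_density (fR1 r)) \<longlonglongrightarrow> 1"
  proof (rule tendsto_sandwich[OF _ _ lower tendsto_const])
    show "\<forall>\<^sub>F r in sequentially. 1 - (3 / 4) ^ r \<le> gamma_density (fR1 r)"
      using eventually_ge_at_top[of 1] by eventually_elim (rule gamma_density_fR1_bounds)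
    show "\<forall>\<^sub>F r in sequentially. gamma_density (fR1 r) \<le> 1"
      using eventually_ge_at_top[of 1] by eventually_elim (rule gamma_density_fR1_bounds)
  qed
qed

end
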